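(* For every positive integer $n$, $\dim \Delta([n]) = \ell(n)-1$.
   Context: Let $p_i$ denote the $i$-th prime and $\mathbb{PP}$ the set of prime powers $p^a$ ($p$ prime, $a\ge 1$). For a positive integer $n$ let $[n]=\{1,2,\dots,n\}$. $\Delta([n])$ is the simplicial complex whose vertex set is $[n]\cap\mathbb{PP}$ and in which a set $\sigma=\{q_1,\dots,q_s\}$ of prime powers is a simplex if and only if the $q_i$ are pairwise relatively prime and $q_1\cdots q_s\le n$ (the empty set is a simplex, of dimension $-1$). The dimension of a simplex is its cardinality minus one, and the dimension of a complex is the maximal dimension of its simplices. $\ell(n)$ is the unique non-negative integer such that $\prod_{i=1}^{\ell(n)}p_i\le n<\prod_{i=1}^{\ell(n)+1}p_i$ (empty products equal $1$). *)

theory Defs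
  imports "HOL-Number_Theory.Prime_Powers" "HOL-Library.Infinite_Set"
begin

text \<open>
  Primes are numbered from 1, so that \<open>nth_prime 1 = 2\<close>, whereas \<^const>\<open>enumerate\<close>
  counts from 0. The value \<open>nth_prime 0\<close> is never used.
\<close>

definition nth_prime :: "nat \<Rightarrow> nat" where
  "nth_prime i = enumerate {p. prime p} (i - 1)"

definition ell :: "nat \<Rightarrow> nat" where
  "ell n = (THE l. (\<Prod>i = 1..l. nth_prime i) \<le> n \<and> n < (\<Prod>i = 1..l + 1. nth_prime i))"

text \<open>
  An abstract simplicial complex is represented by its set of simplices, including the
  empty simplex. Dimensions are integers, as the empty simplex has dimension \<open>-1\<close>.
\<close>

definition simplex_dim :: "'a set \<Rightarrow> int" where
  "simplex_dim \<sigma> = int (card \<sigma>) - 1"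

text \<open>Only meaningful for nonempty complexes whose simplices have bounded size.\<close>

definition complex_dim :: "'a set set \<Rightarrow> int" where
  "complex_dim K = Max (simplex_dim ` K)"

definition Delta_vertices :: "nat \<Rightarrow> nat set" where
  "Delta_vertices n = {1..n} \<inter> {q. primepow q}"

definition Delta :: "nat \<Rightarrow> nat set set" where
  "Delta n = {\<sigma>. \<sigma> \<subseteq> Delta_vertices n \<and> pairwise coprime \<sigma> \<and> \<Prod>\<sigma> \<le> n}"

end

theory Submission imports Defs begin

text \<open>
  Write \<open>P l\<close> for the product of the first \<open>l\<close> primes. Everything rests on the fact that \<open>P k\<close> is
  the least possible product of a simplex with \<open>k\<close> vertices. The bound is attained by the set of
  the first \<open>k\<close> primes. Conversely, pairwise coprime numbers greater than 1, in particular prime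
  powers, share no prime divisor, so replacing each by one of its prime divisors gives \<open>k\<close> distinct primes with no larger product
  (\<open>prod_aprimedivisor_le\<close>), and \<open>k\<close> distinct primes have a product of at least \<open>P k\<close>
  (\<open>prod_enumerate_le_prod\<close>). So \<open>Delta n\<close> has a simplex with \<open>k\<close> vertices if and only if
  \<open>P k \<le> n\<close>, and as \<open>P\<close> is strictly increasing this means \<open>k \<le> ell n\<close>
  (\<open>prod_nth_prime_le_iff\<close>).
\<close>

text \<open>
  The largest element of \<open>T\<close> has at least \<open>card T - 1\<close> elements of \<open>S\<close> below it, which bounds it
  from below by the last factor on the left; removing it from \<open>T\<close> gives an induction.
\<close>

lemma prod_enumerate_le_prod:
  fixes S T :: "nat set"
  assumes "infinite S" and "finite T" and "T \<subseteq> S"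
  shows "(\<Prod>i<card T. enumerate S i) \<le> \<Prod>T"
  using assms(2,3)
proof (induction T rule: finite_linorder_max_induct)
  case empty
  show ?case by simp
next
  case (insert m T)
  obtain j where j: "enumerate S j = m"
    using enumerate_Ex[OF assms(1)] insert.prems by blast
  have "T \<subseteq> enumerate S ` {..<j}"
  proof
    fix t assume "t \<in> T"
    then obtain i where "enumerate S i = t"
      using enumerate_Ex[OF assms(1)] insert.prems by blast
    moreover have "enumerate S i < enumerate S j"
      using \<open>enumerate S i = t\<close> insert.hyps \<open>t \<in> T\<close> j by auto
    ultimately show "t \<in> enumerate S ` {..<j}"
      using assms(1) by auto
  qed
  then have "card T \<le> j"
    using surj_card_le[of "{..<j}" T] by simp
  then have "enumerate S (card T) \<le> m"
    using assms(1) by (simp flip: j)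
  moreover have "m \<notin> T"
    using insert.hyps by blast
  ultimately show ?case
    using insert by (simp add: mult.commute[of m] mult_le_mono)
qed

lemma prime_nth_prime: "prime (nth_prime i)"
  using enumerate_in_set[OF primes_infinite] by (simp add: nth_prime_def)

lemma inj_on_nth_prime: "inj_on nth_prime {1..l}"
proof (rule inj_onI)
  fix i j assume "i \<in> {1..l}" "j \<in> {1..l}" "nth_prime i = nth_prime j"
  moreover from this have "i - 1 = j - 1"
    using injD[OF inj_enumerate[OF primes_infinite]] by (simp add: nth_prime_def)
  ultimately show "i = j" by auto
qed

lemma prod_nth_prime_eq: "(\<Prod>i = 1..l. nth_prime i) = (\<Prod>i<l. enumerate {p. prime p} i)"
  by (rule prod.reindex_bij_witness[of _ Suc "\<lambda>i. i - 1"]) (auto simp: nth_prime_def)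

lemma strict_mono_prod_nth_prime: "strict_mono (\<lambda>l. \<Prod>i = 1..l. nth_prime i)"
proof (rule iffD2[OF strict_mono_Suc_iff], rule allI)
  fix l
  have "(\<Prod>i = 1..l. nth_prime i) > 0"
    by (rule prod_pos) (simp add: prime_gt_0_nat prime_nth_prime)
  then show "(\<Prod>i = 1..l. nth_prime i) < (\<Prod>i = 1..Suc l. nth_prime i)"
    using prime_gt_1_nat[OF prime_nth_prime] by simp
qed

text \<open>
  The products increase strictly with \<open>l\<close> and are therefore at least \<open>l\<close>, so only finitely many are
  at most \<open>n\<close>, and those are the ones up to the last. The empty product is among them because
  \<open>n > 0\<close>. This index is the only candidate for the definite description \<open>ell n\<close>.
\<close>

lemma prod_nth_prime_le_iff:
  assumes "n > 0"
  shows "(\<Prod>i = 1..l. nth_prime i) \<le> n \<longleftrightarrow> l \<le> ell n"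
proof -
  define P where "P l = (\<Prod>i = 1..l. nth_prime i)" for l
  have mono: "strict_mono P"
    using strict_mono_prod_nth_prime by (simp add: P_def[abs_def])
  define L where "L = (GREATEST l. P l \<le> n)"
  have bound: "l \<le> n" if "P l \<le> n" for l
    using strict_mono_imp_increasing[OF mono, of l] that by linarith
  have "P 0 \<le> n"
    using assms by (simp add: P_def)
  then have 1: "P L \<le> n"
    unfolding L_def by (rule GreatestI_nat) (rule bound)
  have 2: "l \<le> L" if "P l \<le> n" for l
    unfolding L_def using that bound by (rule Greatest_le_nat)
  have iff: "P l \<le> n \<longleftrightarrow> l \<le> L" for l
    using 1 2 strict_mono_less_eq[OF mono, of l L] order_trans by blast
  have "ell n = (THE l. P l \<le> n \<and> n < P (l + 1))"
    by (simp only: ell_def P_def)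
  also have "\<dots> = L"
    by (rule the_equality) (auto simp: iff simp flip: not_le)
  finally show ?thesis
    using iff by (simp add: P_def)
qed

lemma inj_on_aprimedivisor:
  fixes A :: "nat set"
  assumes "\<And>q. q \<in> A \<Longrightarrow> q > 1" and "pairwise coprime A"
  shows "inj_on aprimedivisor A"
proof (rule inj_onI, rule ccontr)
  fix q r assume qr: "q \<in> A" "r \<in> A" "aprimedivisor q = aprimedivisor r" "q \<noteq> r"
  have "q > 1" "r > 1"
    using qr assms(1) by auto
  then have "prime (aprimedivisor q)" "aprimedivisor q dvd q" "aprimedivisor r dvd r"
    by (auto intro: prime_aprimedivisor' aprimedivisor_dvd')
  moreover have "coprime q r"
    using qr assms(2) by (auto dest: pairwiseD)
  ultimately show False
    using qr(3) coprime_common_divisor not_prime_unit by metis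
qed

lemma prod_aprimedivisor_le:
  fixes A :: "nat set"
  assumes "\<And>q. q \<in> A \<Longrightarrow> q > 1" and "pairwise coprime A"
  shows "\<Prod>(aprimedivisor ` A) \<le> \<Prod>A"
proof -
  have "\<Prod>(aprimedivisor ` A) = (\<Prod>q\<in>A. aprimedivisor q)"
    using inj_on_aprimedivisor[OF assms] by (simp add: prod.reindex)
  also have "\<dots> \<le> \<Prod>A"
  proof (rule prod_mono)
    fix q assume "q \<in> A"
    then show "0 \<le> aprimedivisor q \<and> aprimedivisor q \<le> q"
      using assms(1) aprimedivisor_le_nat by simp
  qed
  finally show ?thesis .
qed

lemma prod_nth_prime_le_prod:
  fixes A :: "nat set"
  assumes "finite A" and "\<And>q. q \<in> A \<Longrightarrow> q > 1" and "pairwise coprime A"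
  shows "(\<Prod>i = 1..card A. nth_prime i) \<le> \<Prod>A"
proof -
  have "prime (aprimedivisor q)" if "q \<in> A" for q
    using assms(2)[OF that] by (simp add: prime_aprimedivisor')
  then have "(\<Prod>i<card (aprimedivisor ` A). enumerate {p. prime p} i) \<le> \<Prod>(aprimedivisor ` A)"
    using assms(1) by (intro prod_enumerate_le_prod primes_infinite) auto
  also have "\<dots> \<le> \<Prod>A"
    using assms(2,3) by (rule prod_aprimedivisor_le)
  finally show ?thesis
    using inj_on_aprimedivisor[OF assms(2,3)] by (simp only: card_image prod_nth_prime_eq)
qed

lemma first_primes_in_Delta:
  assumes "(\<Prod>i = 1..l. nth_prime i) \<le> n"
  shows "nth_prime ` {1..l} \<in> Delta n"
proof -
  let ?A = "nth_prime ` {1..l}"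
  have prod: "\<Prod>?A \<le> n"
    using assms inj_on_nth_prime[of l] by (simp add: prod.reindex)
  have pos: "\<Prod>?A > 0"
    by (rule prod_pos) (auto simp: prime_gt_0_nat prime_nth_prime)
  have "q \<in> Delta_vertices n" if "q \<in> ?A" for q
  proof -
    have "q dvd \<Prod>?A"
      using that by (intro dvd_prodI[of ?A q "\<lambda>x. x"]) auto
    then have "q \<le> n"
      using pos prod dvd_imp_le by (meson le_trans)
    moreover have "prime q"
      using that prime_nth_prime by blast
    ultimately show ?thesis
      using prime_ge_1_nat by (auto simp: Delta_vertices_def)
  qed
  moreover have "pairwise coprime ?A"
    by (auto simp: pairwise_def prime_nth_prime intro: primes_coprime)
  ultimately show ?thesis
    using prod by (auto simp: Delta_def)
qed

theorem lemma6p2: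
  fixes n :: nat
  assumes "n > 0"
  shows "complex_dim (Delta n) = int (ell n) - 1"
proof -
  have "Delta n \<subseteq> Pow {1..n}"
    by (auto simp: Delta_def Delta_vertices_def)
  then have "finite (Delta n)"
    by (rule finite_subset) simp
  moreover have "simplex_dim \<sigma> \<le> int (ell n) - 1" if "\<sigma> \<in> Delta n" for \<sigma>
  proof -
    have "finite \<sigma>" "\<And>q. q \<in> \<sigma> \<Longrightarrow> q > 1" "pairwise coprime \<sigma>" "\<Prod>\<sigma> \<le> n"
      using that finite_subset[of \<sigma> "{1..n}"] by (auto simp: Delta_def Delta_vertices_def primepow_gt_Suc_0)
    then have "(\<Prod>i = 1..card \<sigma>. nth_prime i) \<le> n"
      using prod_nth_prime_le_prod order_trans by blast
    then show ?thesis
      using prod_nth_prime_le_iff[OF assms] by (simp add: simplex_dim_def)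
  qed
  moreover have "int (ell n) - 1 \<in> simplex_dim ` Delta n"
  proof (rule image_eqI)
    show "nth_prime ` {1..ell n} \<in> Delta n"
      using prod_nth_prime_le_iff[OF assms] by (intro first_primes_in_Delta) simp
    show "int (ell n) - 1 = simplex_dim (nth_prime ` {1..ell n})"
      by (simp only: simplex_dim_def card_image[OF inj_on_nth_prime] card_atLeastAtMost)
  qed
  ultimately show ?thesis
    unfolding complex_dim_def by (intro Max_eqI) auto
qed

end
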